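(* (a) In every interior equilibrium, the ex-ante expected add-on satisfies $$\tfrac12\bar S\le\sum_{\theta\in\Theta}\mu(\theta)\bar q(\theta)\le\bar S-\Delta .$$ (b) The lower bound can be approximated arbitrarily well: for all real $v^*,c$ with $\Delta=v^*-c>0$, every $\bar S>2\Delta$ and every $\eta>0$, there exist $n$, $\Theta$, $S$, $\mu$, $\mathcal{M}$ as in the context with $\sum_\theta\mu(\theta)S(\theta)=\bar S$ and an interior equilibrium under these primitives for which $\sum_\theta\mu(\theta)\bar q(\theta)<\frac12\bar S+\eta$.
   Context: Primitives: $\Theta=\Theta_1\times\cdots\times\Theta_n$ is a finite set of states; $\mu$ is a full-support probability distribution on $\Theta$; $S:\Theta\to(0,\infty)$ is one-to-one; $\bar S=\sum_\theta\mu(\theta)S(\theta)$; $v^*,c$ are real numbers with $\Delta=v^*-c>0$; $\mathcal{M}$ is a finite nonempty collection of subsets of $\{1,\dots,n\}$ (consumers' cognitive types). For $M\subseteq\{1,\dots,n\}$ write $\theta_M=(\theta_i)_{i\in M}$, and let $\mu(\theta'\mid\theta'_M=\theta_M)$ be $\mu(\theta')/\sum_{\theta'':\theta''_M=\theta_M}\mu(\theta'')$ if $\theta'_M=\theta_M$, and $0$ otherwise. Firms have types $\pi\sim U[0,1]$; a type-$\pi$ firm is active at state $\theta$ and price $\phi$ iff $\phi-c+\pi S(\theta)\ge0$, and its add-on is $\pi S(\theta)$. Let $\pi^\star(\theta,\phi)=(c-\phi)/S(\theta)$ be the marginal type. For a price function $h:\Theta\to\mathbb{R}$, the expected add-on among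 active firms in state $\theta$ is $\bar q(\theta)=\frac{1+\pi^\star(\theta,h(\theta))}{2}S(\theta)$. Equilibrium (homogeneous-preference limit, in which all consumers' bare valuation is $v^*$ and equilibrium prices are taken to be fully revealing): $h:\Theta\to\mathbb{R}$ is an interior equilibrium if for every $\theta$, $\pi^\star(\theta,h(\theta))\in(0,1)$ and $$h(\theta)=v^*-\min_{M\in\mathcal{M}}\sum_{\theta'}\mu(\theta'\mid\theta'_M=\theta_M)\,\bar q(\theta').$$ *)

theory Defs
  imports "HOL-Probability.Probability"
begin

text \<open>
  A state is a function on the coordinates \<open>1..n\<close> (undefined elsewhere), so that
  \<open>restrict \<theta> M\<close> is the subvector of \<open>\<theta>\<close> indexed by \<open>M\<close>.
\<close>

definition states :: "nat \<Rightarrow> (nat \<Rightarrow> 'a set) \<Rightarrow> (nat \<Rightarrow> 'a) set" where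
  "states n \<Theta> = PiE {1..n} \<Theta>"

locale primitives =
  fixes n :: nat and \<Theta> :: "nat \<Rightarrow> 'a set" and \<mu> :: "(nat \<Rightarrow> 'a) pmf"
    and S :: "(nat \<Rightarrow> 'a) \<Rightarrow> real" and \<M> :: "nat set set" and vstar c :: real
  assumes n_pos: "1 \<le> n"
    and finite_states: "finite (states n \<Theta>)"
    and full_support: "set_pmf \<mu> = states n \<Theta>"
    and S_pos: "\<And>\<theta>. \<theta> \<in> states n \<Theta> \<Longrightarrow> 0 < S \<theta>"
    and S_inj: "inj_on S (states n \<Theta>)"
    and types: "\<M> \<subseteq> Pow {1..n}" "finite \<M>" "\<M> \<noteq> {}"
    and Delta_pos: "0 < vstar - c"

definition ex_ante :: "nat \<Rightarrow> (nat \<Rightarrow> 'a set) \<Rightarrow> (nat \<Rightarrow> 'a) pmf \<Rightarrow> ((nat \<Rightarrow> 'a) \<Rightarrow> real) \<Rightarrow> real" where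
  "ex_ante n \<Theta> \<mu> f = (\<Sum>\<theta>\<in>states n \<Theta>. pmf \<mu> \<theta> * f \<theta>)"

definition posterior ::
  "nat \<Rightarrow> (nat \<Rightarrow> 'a set) \<Rightarrow> (nat \<Rightarrow> 'a) pmf \<Rightarrow> nat set \<Rightarrow> (nat \<Rightarrow> 'a) \<Rightarrow> (nat \<Rightarrow> 'a) \<Rightarrow> real" where
  "posterior n \<Theta> \<mu> M \<theta> \<theta>' =
    (if restrict \<theta>' M = restrict \<theta> M
     then pmf \<mu> \<theta>' / (\<Sum>\<theta>''\<in>{\<theta>'' \<in> states n \<Theta>. restrict \<theta>'' M = restrict \<theta> M}. pmf \<mu> \<theta>'')
     else 0)"

definition marginal_type :: "((nat \<Rightarrow> 'a) \<Rightarrow> real) \<Rightarrow> real \<Rightarrow> (nat \<Rightarrow> 'a) \<Rightarrow> real \<Rightarrow> real" where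
  "marginal_type S c \<theta> \<phi> = (c - \<phi>) / S \<theta>"

definition active_types :: "((nat \<Rightarrow> 'a) \<Rightarrow> real) \<Rightarrow> real \<Rightarrow> (nat \<Rightarrow> 'a) \<Rightarrow> real \<Rightarrow> real set" where
  "active_types S c \<theta> \<phi> = {\<pi> \<in> {0..1}. 0 \<le> \<phi> - c + \<pi> * S \<theta>}"

definition qbar ::
  "((nat \<Rightarrow> 'a) \<Rightarrow> real) \<Rightarrow> real \<Rightarrow> ((nat \<Rightarrow> 'a) \<Rightarrow> real) \<Rightarrow> (nat \<Rightarrow> 'a) \<Rightarrow> real" where
  "qbar S c h \<theta> = (1 + marginal_type S c \<theta> (h \<theta>)) / 2 * S \<theta>"

definition interior_equilibrium ::
  "nat \<Rightarrow> (nat \<Rightarrow> 'a set) \<Rightarrow> (nat \<Rightarrow> 'a) pmf \<Rightarrow> ((nat \<Rightarrow> 'a) \<Rightarrow> real) \<Rightarrow> nat set set \<Rightarrow> real \<Rightarrow> real \<Rightarrow>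
   ((nat \<Rightarrow> 'a) \<Rightarrow> real) \<Rightarrow> bool" where
  "interior_equilibrium n \<Theta> \<mu> S \<M> vstar c h \<longleftrightarrow>
    (\<forall>\<theta>\<in>states n \<Theta>.
      marginal_type S c \<theta> (h \<theta>) \<in> {0<..<1} \<and>
      h \<theta> = vstar - (MIN M\<in>\<M>. \<Sum>\<theta>'\<in>states n \<Theta>. posterior n \<Theta> \<mu> M \<theta> \<theta>' * qbar S c h \<theta>'))"

text \<open>
  The closed forms used above agree with the probabilistic notions they stand for:
  \<open>posterior\<close> is conditioning of \<open>\<mu>\<close>, and, at an interior marginal type, \<open>qbar\<close> is the
  expectation of the add-on \<open>\<pi> * S \<theta>\<close> for \<open>\<pi>\<close> uniform on \<open>[0,1]\<close> given that \<open>\<pi>\<close> is active.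
\<close>

lemma (in primitives) posterior_eq_cond_pmf:
  assumes "\<theta> \<in> states n \<Theta>" "\<theta>' \<in> states n \<Theta>"
  shows "posterior n \<Theta> \<mu> M \<theta> \<theta>' = pmf (cond_pmf \<mu> {\<theta>''. restrict \<theta>'' M = restrict \<theta> M}) \<theta>'"
proof -
  let ?A = "{\<theta>''. restrict \<theta>'' M = restrict \<theta> M}"
  have ne: "set_pmf \<mu> \<inter> ?A \<noteq> {}"
    using assms full_support by auto
  have "measure (measure_pmf \<mu>) ?A = measure (measure_pmf \<mu>) (set_pmf \<mu> \<inter> ?A)"
    by (subst Int_commute) (rule measure_Int_set_pmf[symmetric])
  also have "\<dots> = (\<Sum>\<theta>''\<in>{\<theta>'' \<in> states n \<Theta>. restrict \<theta>'' M = restrict \<theta> M}. pmf \<mu> \<theta>'')"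
    using finite_states full_support by (subst measure_measure_pmf_finite) (auto intro!: sum.cong)
  finally show ?thesis
    using pmf_cond[OF ne] by (simp add: posterior_def)
qed

lemma qbar_eq_conditional_expectation:
  fixes S :: "(nat \<Rightarrow> 'a) \<Rightarrow> real"
  defines "U \<equiv> uniform_measure lborel {0..1::real}"
  assumes "0 < S \<theta>" and "marginal_type S c \<theta> (h \<theta>) \<in> {0<..<1}"
  shows "qbar S c h \<theta> =
    (LINT \<pi>:active_types S c \<theta> (h \<theta>)|U. \<pi> * S \<theta>) / measure U (active_types S c \<theta> (h \<theta>))"
proof -
  have S: "0 < S \<theta>" by fact
  define p where "p = marginal_type S c \<theta> (h \<theta>)"
  have p: "0 < p" "p < 1" using assms by (auto simp: p_def)
  have act: "0 \<le> h \<theta> - c + \<pi> * S \<theta> \<longleftrightarrow> p \<le> \<pi>" for \<pi>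
    using pos_divide_le_eq[OF S, of "c - h \<theta>" \<pi>] by (auto simp: p_def marginal_type_def)
  have A: "active_types S c \<theta> (h \<theta>) = {p..1}"
    using p(1) unfolding active_types_def act by auto
  have U: "U = density lborel (\<lambda>x. ennreal (indicator {0..1} x))"
    by (simp add: U_def uniform_measure_def ennreal_indicator divide_ennreal_def)
  have "measure U {p..1} = 1 - p"
    using p by (simp add: U_def measure_uniform_measure Int_absorb1)
  moreover have "(LINT \<pi>:{p..1}|U. \<pi> * S \<theta>) = (1 - p\<^sup>2) / 2 * S \<theta>"
  proof -
    have "(LINT \<pi>:{p..1}|U. \<pi> * S \<theta>) = (LINT \<pi>|lborel. indicator {0..1} \<pi> *\<^sub>R (indicator {p..1} \<pi> *\<^sub>R (\<pi> * S \<theta>)))"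
      unfolding U set_lebesgue_integral_def by (subst integral_density) auto
    also have "\<dots> = (LINT \<pi>|lborel. indicator {p..1} \<pi> *\<^sub>R (\<pi> * S \<theta>))"
      using p by (intro Bochner_Integration.integral_cong) (auto simp: indicator_def)
    also have "\<dots> = 1\<^sup>2 / 2 * S \<theta> - p\<^sup>2 / 2 * S \<theta>"
      using p by (intro integral_FTC_Icc[where F = "\<lambda>x. x\<^sup>2 / 2 * S \<theta>"])
        (auto intro!: derivative_eq_intros continuous_intros
              simp flip: has_real_derivative_iff_has_vector_derivative)
    finally show ?thesis by (simp add: field_simps)
  qed
  moreover have "(1 - p\<^sup>2) / 2 * S \<theta> / (1 - p) = (1 + p) / 2 * S \<theta>"
    using p by (simp add: power2_eq_square divide_simps) (simp add: algebra_simps)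
  ultimately show ?thesis
    by (simp only: A qbar_def p_def[symmetric])
qed

end

theory Submission
  imports Defs
begin

text \<open>
  An interior equilibrium satisfies \<open>2 q \<theta> = S \<theta> - \<Delta> + m \<theta>\<close>, where \<open>m \<theta>\<close> is the least conditional
  expectation of \<open>q\<close> over cognitive types. Interiority means \<open>2 q > S\<close>, which is the lower bound.
  The law of iterated expectations for a single type gives \<open>E m \<le> E q\<close>, hence the upper bound.

  For tightness two states and the two types ``ignorant'' and ``fully informed'' suffice. The low
  state has \<open>S = 2 \<Delta> + t\<close> with \<open>t\<close> small, so that \<open>m = \<Delta> + t\<close> there, and the high state has a small
  probability \<open>p\<close>. Ignorance bounds \<open>m\<close> in the high state by \<open>E q\<close>, however large \<open>S\<close> is there.
  So \<open>E m\<close> is close to \<open>\<Delta>\<close>, and \<open>E q\<close> is close to half the mean of \<open>S\<close>.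
\<close>

text \<open>The factor \<open>S \<theta>\<close> cancels in the marginal type, so the add-on is
  affine in the price and the equilibrium condition becomes linear.\<close>

lemma two_qbar:
  assumes "S \<theta> \<noteq> 0"
  shows "2 * qbar S c h \<theta> = S \<theta> + c - h \<theta>"
  using assms by (simp add: qbar_def marginal_type_def field_simps)

context primitives
begin

text \<open>After swapping the sums it suffices that averaging the posteriors over the prior returns
  the prior.\<close>

lemma posterior_iterated_expectation:
  "ex_ante n \<Theta> \<mu> (\<lambda>\<theta>. \<Sum>\<theta>'\<in>states n \<Theta>. posterior n \<Theta> \<mu> M \<theta> \<theta>' * f \<theta>') = ex_ante n \<Theta> \<mu> f"
proof -
  define cell where "cell \<theta> = {\<theta>' \<in> states n \<Theta>. restrict \<theta>' M = restrict \<theta> M}" for \<theta>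
  have avg: "(\<Sum>\<theta>\<in>states n \<Theta>. pmf \<mu> \<theta> * posterior n \<Theta> \<mu> M \<theta> \<theta>') = pmf \<mu> \<theta>'"
    if \<theta>': "\<theta>' \<in> states n \<Theta>" for \<theta>'
  proof -
    have "0 < pmf \<mu> \<theta>'"
      using \<theta>' full_support by (simp add: pmf_positive_iff)
    moreover have "pmf \<mu> \<theta>' \<le> sum (pmf \<mu>) (cell \<theta>')"
      using \<theta>' finite_states by (intro member_le_sum) (auto simp: cell_def)
    ultimately have pos: "sum (pmf \<mu>) (cell \<theta>') > 0"
      by linarith
    \<comment> \<open>Only states in the cell of \<open>\<theta>'\<close> contribute, and they all
      share its mass as normalizer.\<close>
    have "(\<Sum>\<theta>\<in>states n \<Theta>. pmf \<mu> \<theta> * posterior n \<Theta> \<mu> M \<theta> \<theta>')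
        = (\<Sum>\<theta>\<in>cell \<theta>'. pmf \<mu> \<theta> * (pmf \<mu> \<theta>' / sum (pmf \<mu>) (cell \<theta>')))"
      using finite_states
      by (intro sum.mono_neutral_cong_right) (auto simp: cell_def posterior_def)
    also have "\<dots> = pmf \<mu> \<theta>'"
      using pos by (simp only: sum_distrib_right[symmetric]) simp
    finally show ?thesis .
  qed
  have "ex_ante n \<Theta> \<mu> (\<lambda>\<theta>. \<Sum>\<theta>'\<in>states n \<Theta>. posterior n \<Theta> \<mu> M \<theta> \<theta>' * f \<theta>')
      = (\<Sum>\<theta>'\<in>states n \<Theta>. (\<Sum>\<theta>\<in>states n \<Theta>. pmf \<mu> \<theta> * posterior n \<Theta> \<mu> M \<theta> \<theta>') * f \<theta>')"
    unfolding ex_ante_def sum_distrib_left sum_distrib_right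
    by (subst sum.swap) (simp add: mult.assoc)
  also have "\<dots> = ex_ante n \<Theta> \<mu> f"
    by (simp add: avg ex_ante_def)
  finally show ?thesis .
qed

lemma ex_ante_mono:
  "(\<And>\<theta>. \<theta> \<in> states n \<Theta> \<Longrightarrow> f \<theta> \<le> g \<theta>) \<Longrightarrow> ex_ante n \<Theta> \<mu> f \<le> ex_ante n \<Theta> \<mu> g"
  unfolding ex_ante_def by (intro sum_mono mult_left_mono) auto

lemma ex_ante_const: "ex_ante n \<Theta> \<mu> (\<lambda>_. k) = k"
  using sum_pmf_eq_1[OF finite_states, of \<mu>] full_support
  by (simp add: ex_ante_def flip: sum_distrib_right)

lemma ex_ante_add: "ex_ante n \<Theta> \<mu> (\<lambda>\<theta>. f \<theta> + g \<theta>) = ex_ante n \<Theta> \<mu> f + ex_ante n \<Theta> \<mu> g"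
  by (simp add: ex_ante_def algebra_simps sum.distrib)

lemma ex_ante_scale: "ex_ante n \<Theta> \<mu> (\<lambda>\<theta>. k * f \<theta>) = k * ex_ante n \<Theta> \<mu> f"
  by (simp add: ex_ante_def sum_distrib_left mult.left_commute)

lemma equilibrium_add_on_lower:
  assumes "interior_equilibrium n \<Theta> \<mu> S \<M> vstar c h"
  shows "1 / 2 * ex_ante n \<Theta> \<mu> S \<le> ex_ante n \<Theta> \<mu> (qbar S c h)"
proof -
  have "1 / 2 * S \<theta> \<le> qbar S c h \<theta>" if "\<theta> \<in> states n \<Theta>" for \<theta>
    unfolding qbar_def
    using assms S_pos[OF that] that
    by (intro mult_right_mono) (auto simp: interior_equilibrium_def less_imp_le)
  then show ?thesis
    unfolding ex_ante_scale[symmetric] by (rule ex_ante_mono)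
qed

text \<open>Any one type bounds the minimum from above. Averaging
  \<open>2 q \<le> S - \<Delta> + E\<close> leaves a copy of the mean of \<open>q\<close> on the
  right, which is cancelled.\<close>

lemma equilibrium_add_on_upper:
  assumes eq: "interior_equilibrium n \<Theta> \<mu> S \<M> vstar c h"
  shows "ex_ante n \<Theta> \<mu> (qbar S c h) \<le> ex_ante n \<Theta> \<mu> S - (vstar - c)"
proof -
  let ?q = "qbar S c h"
  obtain M where M: "M \<in> \<M>" using types by blast
  define E where "E \<theta> = (\<Sum>\<theta>'\<in>states n \<Theta>. posterior n \<Theta> \<mu> M \<theta> \<theta>' * ?q \<theta>')" for \<theta>
  have "2 * ?q \<theta> \<le> S \<theta> + (E \<theta> + (c - vstar))" if \<theta>: "\<theta> \<in> states n \<Theta>" for \<theta>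
  proof -
    have "vstar - h \<theta> \<le> E \<theta>"
      using eq \<theta> M types by (auto simp: interior_equilibrium_def E_def intro!: Min_le)
    then show ?thesis
      using two_qbar[of S \<theta> c h] S_pos[OF \<theta>] by linarith
  qed
  then have "2 * ex_ante n \<Theta> \<mu> ?q \<le> ex_ante n \<Theta> \<mu> (\<lambda>\<theta>. S \<theta> + (E \<theta> + (c - vstar)))"
    unfolding ex_ante_scale[symmetric] by (rule ex_ante_mono)
  also have "\<dots> = ex_ante n \<Theta> \<mu> S + (ex_ante n \<Theta> \<mu> ?q + (c - vstar))"
    by (simp add: ex_ante_add ex_ante_const E_def posterior_iterated_expectation)
  finally show ?thesis by linarith
qed

end

lemma lower_bound_approximable:
  fixes vstar c Sbar \<eta> :: real
  assumes "0 < vstar - c" "2 * (vstar - c) < Sbar" "0 < \<eta>"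
  shows "\<exists>(n::nat) (\<Theta> :: nat \<Rightarrow> nat set) \<mu> S \<M> h.
           primitives n \<Theta> \<mu> S \<M> vstar c \<and>
           ex_ante n \<Theta> \<mu> S = Sbar \<and>
           interior_equilibrium n \<Theta> \<mu> S \<M> vstar c h \<and>
           ex_ante n \<Theta> \<mu> (qbar S c h) < 1 / 2 * Sbar + \<eta>"
proof -
  \<comment> \<open>Keeps the coordinate \<open>1\<close> from being rewritten to
    \<open>Suc 0\<close>.\<close>
  note One_nat_def [simp del]
  define \<Delta> where "\<Delta> = vstar - c"
  define d where "d = Sbar - 2 * \<Delta>"
  \<comment> \<open>With this choice \<open>t = p * d = \<eta> * d / (\<eta> + d)\<close> lies below
    both \<open>d\<close> and \<open>\<eta>\<close>.\<close>
  define p where "p = \<eta> / (\<eta> + d)"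
  define t where "t = p * d"
  define a where "a = 2 * \<Delta> + t"
  \<comment> \<open>\<open>Q\<close> is the mean add-on: it solves \<open>Q = (1 - p) (\<Delta> + t) + p (H - \<Delta> + Q) / 2\<close>.\<close>
  define H where "H = (Sbar - (1 - p) * a) / p"
  define Q where "Q = (Sbar - \<Delta> + (1 - p) * (\<Delta> + t)) / (2 - p)"
  have \<Delta>: "0 < \<Delta>" and d: "0 < d" and Sbar: "Sbar = 2 * \<Delta> + d"
    using assms by (auto simp: \<Delta>_def d_def)
  have p: "0 < p" "p < 1" and pd: "t < \<eta>"
    using d assms(3) by (auto simp: p_def t_def field_simps)
  have t: "0 < t" "t < d"
    using p d by (auto simp: t_def)
  have pH: "p * H = Sbar - (1 - p) * a"
    using p by (simp add: H_def)
  have Q: "(2 - p) * Q = Sbar - \<Delta> + (1 - p) * (\<Delta> + t)"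
    using p by (simp add: Q_def)
  \<comment> \<open>\<open>Sbar\<close> is the weighted mean of \<open>a\<close> and
    \<open>H\<close>; as \<open>a\<close> lies below it, \<open>H\<close> lies above.\<close>
  have H_gt: "Sbar < H"
  proof -
    have "a < Sbar"
      using t by (simp add: a_def Sbar)
    then have "p * Sbar < p * H"
      unfolding pH using mult_strict_left_mono[of a Sbar "1 - p"] p
      by (simp add: left_diff_distrib)
    then show ?thesis using p by simp
  qed
  have Q_ge: "\<Delta> + t < Q"
  proof -
    have "(2 - p) * (\<Delta> + t) < (2 - p) * Q"
      unfolding Q using t by (simp add: Sbar algebra_simps)
    then show ?thesis using p by simp
  qed
  have Q_less: "Q < \<Delta> + d"
  proof -
    have "(2 - p) * Q < (2 - p) * (\<Delta> + d)"
      unfolding Q using mult_strict_left_mono[of t d "1 - p"] p t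
      by (simp add: Sbar algebra_simps)
    then show ?thesis using p by simp
  qed
  have Q_bound: "Q < 1 / 2 * Sbar + \<eta>"
  proof -
    \<comment> \<open>The first \<open>t\<close> on the right is \<open>p * d\<close>, left over
      from splitting off \<open>(2 - p) * Sbar\<close>.\<close>
    have "(2 - p) * (2 * Q) = (2 - p) * Sbar + t + 2 * (1 - p) * t"
      using Q by (simp add: Sbar t_def algebra_simps)
    also have "\<dots> \<le> (2 - p) * (Sbar + 2 * t)"
      using p t by (simp add: algebra_simps)
    finally have "2 * Q \<le> Sbar + 2 * t"
      using p by simp
    then show ?thesis using pd by simp
  qed

  define lo hi :: "nat \<Rightarrow> nat" where "lo = (\<lambda>i\<in>{1}. 0)" and "hi = (\<lambda>i\<in>{1}. 1)"
  define \<Theta> :: "nat \<Rightarrow> nat set" where "\<Theta> = (\<lambda>_. {0, 1})"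
  define \<mu> where "\<mu> = map_pmf (\<lambda>b. if b then hi else lo) (bernoulli_pmf p)"
  define S :: "(nat \<Rightarrow> nat) \<Rightarrow> real" where "S \<theta> = (if \<theta> = hi then H else a)" for \<theta>
  define \<M> :: "nat set set" where "\<M> = {{}, {1}}"
  \<comment> \<open>Since \<open>c = vstar - \<Delta>\<close>, these prices are
    \<open>vstar - Q\<close> and \<open>vstar - (\<Delta> + t)\<close>: the ignorant type is to
    attain the minimum in the high state, the informed one in the low state.\<close>
  define h :: "(nat \<Rightarrow> nat) \<Rightarrow> real" where
    "h \<theta> = (if \<theta> = hi then c - (Q - \<Delta>) else c - t)" for \<theta>
  have lohi: "lo 1 = 0" "hi 1 = 1" by (simp_all add: lo_def hi_def)
  then have ne: "lo \<noteq> hi" by auto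
  have states: "states 1 \<Theta> = {lo, hi}"
    unfolding states_def \<Theta>_def lo_def hi_def atLeastAtMost_singleton
      PiE_over_singleton_iff
    by blast
  have pmf_lo: "pmf \<mu> lo = 1 - p"
    using ne p pmf_map_inj'[of "\<lambda>b. if b then hi else lo" "bernoulli_pmf p" False]
    by (auto simp: \<mu>_def inj_def)
  have pmf_hi: "pmf \<mu> hi = p"
    using ne p pmf_map_inj'[of "\<lambda>b. if b then hi else lo" "bernoulli_pmf p" True]
    by (auto simp: \<mu>_def inj_def)
  have prim: "primitives 1 \<Theta> \<mu> S \<M> vstar c"
  proof
    show "set_pmf \<mu> = states 1 \<Theta>"
      using p by (auto simp: states \<mu>_def UNIV_bool)
  qed (use ne \<Delta> d t H_gt in \<open>auto simp: states S_def \<M>_def a_def Sbar \<Delta>_def inj_on_def\<close>)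
  have ex_ante: "ex_ante 1 \<Theta> \<mu> f = (1 - p) * f lo + p * f hi" for f
    using ne by (simp add: ex_ante_def states pmf_lo pmf_hi)
  have q_lo: "qbar S c h lo = \<Delta> + t"
    using ne \<Delta> t two_qbar[of S lo c h] by (simp add: S_def h_def a_def)
  have q_hi: "2 * qbar S c h hi = H - \<Delta> + Q"
    using \<Delta> d H_gt two_qbar[of S hi c h] by (simp add: S_def h_def Sbar)
  \<comment> \<open>Consistency check: the high price was built from \<open>Q\<close>, and the
    add-ons it induces do have mean \<open>Q\<close>.\<close>
  have q_mean: "ex_ante 1 \<Theta> \<mu> (qbar S c h) = Q"
  proof -
    have "2 * ex_ante 1 \<Theta> \<mu> (qbar S c h) = 2 * (1 - p) * (\<Delta> + t) + p * H - p * \<Delta> + p * Q"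
      using arg_cong[OF q_hi, of "(*) p"] by (simp add: ex_ante q_lo algebra_simps)
    also have "\<dots> = 2 * Q"
      unfolding pH a_def using Q by (simp add: algebra_simps)
    finally show ?thesis by simp
  qed
  \<comment> \<open>Restriction to the empty set identifies all states, so the posterior is the
    prior.\<close>
  have ignorant: "(\<Sum>\<theta>'\<in>states 1 \<Theta>. posterior 1 \<Theta> \<mu> {} \<theta> \<theta>' * qbar S c h \<theta>') = Q" for \<theta>
  proof -
    have "(\<Sum>\<theta>''\<in>states 1 \<Theta>. pmf \<mu> \<theta>'') = 1"
      using ne by (simp add: states pmf_lo pmf_hi)
    then have "posterior 1 \<Theta> \<mu> {} \<theta> \<theta>' = pmf \<mu> \<theta>'" for \<theta>'
      by (simp add: posterior_def restrict_def)
    then show ?thesis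
      using q_mean by (simp add: ex_ante_def)
  qed
  have informed: "(\<Sum>\<theta>'\<in>states 1 \<Theta>. posterior 1 \<Theta> \<mu> {1} \<theta> \<theta>' * qbar S c h \<theta>') = qbar S c h \<theta>"
    if "\<theta> \<in> states 1 \<Theta>" for \<theta>
  proof -
    have r: "restrict \<theta>' {1} = \<theta>'" if "\<theta>' \<in> states 1 \<Theta>" for \<theta>'
      using that unfolding states_def by (simp add: PiE_restrict)
    have "{\<theta>' \<in> states 1 \<Theta>. restrict \<theta>' {1} = restrict \<theta> {1}} = {\<theta>}"
      using r that by auto
    moreover have "pmf \<mu> \<theta> \<noteq> 0"
      using p that pmf_lo pmf_hi unfolding states by fastforce
    ultimately have "posterior 1 \<Theta> \<mu> {1} \<theta> \<theta>' = (if \<theta>' = \<theta> then 1 else 0)"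
      if "\<theta>' \<in> states 1 \<Theta>" for \<theta>'
      unfolding posterior_def using r[OF that] r[OF \<open>\<theta> \<in> states 1 \<Theta>\<close>] by simp
    then have "(\<Sum>\<theta>'\<in>states 1 \<Theta>. posterior 1 \<Theta> \<mu> {1} \<theta> \<theta>' * qbar S c h \<theta>')
        = (\<Sum>\<theta>'\<in>states 1 \<Theta>. if \<theta>' = \<theta> then qbar S c h \<theta>' else 0)"
      by (intro sum.cong) auto
    then show ?thesis
      using that by (simp add: states)
  qed
  have "interior_equilibrium 1 \<Theta> \<mu> S \<M> vstar c h"
    unfolding interior_equilibrium_def
  proof
    fix \<theta> assume \<theta>: "\<theta> \<in> states 1 \<Theta>"
    have "(MIN M\<in>\<M>. \<Sum>\<theta>'\<in>states 1 \<Theta>. posterior 1 \<Theta> \<mu> M \<theta> \<theta>' * qbar S c h \<theta>')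
        = min Q (qbar S c h \<theta>)"
      using informed[OF \<theta>] by (simp add: \<M>_def ignorant)
    moreover have "h \<theta> = vstar - min Q (qbar S c h \<theta>)"
    proof (cases "\<theta> = hi")
      case True
      \<comment> \<open>By \<open>q_hi\<close> this amounts to \<open>Q \<le> H - \<Delta>\<close>,
        and \<open>Q < \<Delta> + d = Sbar - \<Delta> < H - \<Delta>\<close>.\<close>
      moreover have "Q \<le> qbar S c h hi"
        using q_hi Q_less H_gt \<Delta> Sbar by linarith
      ultimately show ?thesis by (simp add: h_def \<Delta>_def)
    next
      case False
      with \<theta> have "\<theta> = lo" unfolding states by blast
      with ne q_lo Q_ge show ?thesis by (simp add: h_def \<Delta>_def)
    qed
    \<comment> \<open>The gap \<open>c - h \<theta>\<close> is \<open>t < a\<close> in the low state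
      and \<open>Q - \<Delta> < d < H\<close> in the high one.\<close>
    moreover have "0 < c - h \<theta> \<and> c - h \<theta> < S \<theta>"
      using t \<Delta> d Q_ge Q_less H_gt by (simp add: h_def S_def a_def Sbar)
    then have "marginal_type S c \<theta> (h \<theta>) \<in> {0<..<1}"
      by (simp add: marginal_type_def)
    ultimately show "marginal_type S c \<theta> (h \<theta>) \<in> {0<..<1} \<and>
      h \<theta> = vstar - (MIN M\<in>\<M>. \<Sum>\<theta>'\<in>states 1 \<Theta>. posterior 1 \<Theta> \<mu> M \<theta> \<theta>' * qbar S c h \<theta>')"
      by simp
  qed
  moreover have "ex_ante 1 \<Theta> \<mu> S = Sbar"
    using ne pH by (simp add: ex_ante S_def)
  ultimately show ?thesis
    using prim q_mean Q_bound by blast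
qed

theorem proposition4:
  shows
    "(\<forall>(n::nat) (\<Theta> :: nat \<Rightarrow> 'a set) \<mu> S \<M> vstar c h.
        primitives n \<Theta> \<mu> S \<M> vstar c \<and> interior_equilibrium n \<Theta> \<mu> S \<M> vstar c h \<longrightarrow>
        1 / 2 * ex_ante n \<Theta> \<mu> S \<le> ex_ante n \<Theta> \<mu> (qbar S c h) \<and>
        ex_ante n \<Theta> \<mu> (qbar S c h) \<le> ex_ante n \<Theta> \<mu> S - (vstar - c))
     \<and>
     (\<forall>(vstar::real) (c::real) (Sbar::real) (\<eta>::real).
        0 < vstar - c \<and> 2 * (vstar - c) < Sbar \<and> 0 < \<eta> \<longrightarrow>
        (\<exists>(n::nat) (\<Theta> :: nat \<Rightarrow> nat set) \<mu> S \<M> h.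
           primitives n \<Theta> \<mu> S \<M> vstar c \<and>
           ex_ante n \<Theta> \<mu> S = Sbar \<and>
           interior_equilibrium n \<Theta> \<mu> S \<M> vstar c h \<and>
           ex_ante n \<Theta> \<mu> (qbar S c h) < 1 / 2 * Sbar + \<eta>))"
  by (intro conjI allI impI; (elim conjE)?)
    (rule primitives.equilibrium_add_on_lower primitives.equilibrium_add_on_upper
      lower_bound_approximable; assumption)+

end
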